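(* Let $\mathcal P=(\mathcal{PV},\mathcal L,\mathcal{GT},\ell_0)$ be a probabilistic integer program and let $(\mathcal{RT}^\sqcap,\mathcal{S}^\sqcap)$ be a (non-probabilistic) bound pair for $\mathcal P$, i.e., $\mathcal{RT}^\sqcap:\mathcal T\to\mathcal B$ is a runtime bound and $\mathcal{S}^\sqcap:\mathcal T\times\mathcal V\to\mathcal B$ is a size bound. Define $\mathcal{RT}_{\mathbb E}^\sqcap:\mathcal{GT}\to\mathcal B$ and $\mathcal{S}_{\mathbb E}^\sqcap:\mathcal{GRV}\to\mathcal B$ by $\mathcal{RT}_{\mathbb E}^\sqcap(g)=\sum_{t\in g}\mathcal{RT}^\sqcap(t)$ and $\mathcal{S}_{\mathbb E}^\sqcap(g,\ell,x)=\sum_{t=(\_,\_,\_,\_,\ell)\in g}\mathcal{S}^\sqcap(t,x)$ (the sum over all transitions of $g$ whose target location is $\ell$). Then $(\mathcal{RT}_{\mathbb E}^\sqcap,\mathcal{S}_{\mathbb E}^\sqcap)$ is an expected bound pair, i.e., $\mathcal{RT}_{\mathbb E}^\sqcap$ is an expected runtime bound and $\mathcal{S}_{\mathbb E}^\sqcap$ is an expected size bound.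
   Context: States: $\mathcal V$ is a finite set of variables, a state is a map $s:\mathcal V\to\mathbb Z$, $\Sigma$ is the set of states, and $|s|$ is the state with $|s|(x)=|s(x)|$. Constraints are finite conjunctions of inequalities $e_1\le e_2$ with $e_1,e_2\in\mathbb Z[\mathcal V]$. $\mathrm{Dist}(\mathbb Z)$ is the set of probability distributions on $\mathbb Z$ with well-defined finite expected value; a distribution function is a map $d:\Sigma\to\mathrm{Dist}(\mathbb Z)$, and $\mathcal D$ is the set of distribution functions. A probabilistic integer program (PIP) $(\mathcal{PV},\mathcal L,\mathcal{GT},\ell_0)$ consists of a finite set $\mathcal{PV}\subseteq\mathcal V$ of program variables (variables in $\mathcal V\setminus\mathcal{PV}$ are temporary), a finite nonempty set $\mathcal L$ of locations, an initial location $\ell_0$ that is the target of no transition, and a finite nonempty set $\mathcal{GT}$ of general transitions. A general transition $g$ is a finite nonempty set of transitions $t=(\ell,p,\tau,\eta,\ell')$ (start location $\ell$, probability $p\ge0$, guard constraint $\tau$, update $\eta:\mathcal{PV}\to\mathbb Z[\mathcal V]\cup\mathcal D$, target location $\ell'$); all transitions of $g$ share the same start location $\ell_g$ and guard $\tau_g$, and their probabilities sum to $1$. Let $\mathcal T=\bigcup_{g\in\mathcal{GT}}g$. Configurations are triples $(\ell,t,s)\in(\mathcal L\uplus\{\ell_\bot\})\times(\mathcal T\uplus\{t_{in},t_\bot\})\times\Sigma$; a run is an infinite sequence of configurations, a finite path a finite one; $g_\bot=\{t_\bot\}$. A scheduler $\mathfrak S$ maps each configuration $(\ell,t,s)$ to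 a pair $(g,s')$ where $s'$ agrees with $s$ on $\mathcal{PV}$, $g\in\mathcal{GT}$ with $\ell_g=\ell$ and $s'(\tau_g)$ true; if $\ell=\ell_\bot$, $t=t_\bot$, or no such pair exists, it returns $(g_\bot,s)$. For a scheduler $\mathfrak S$ and initial state $s_0$, a run starts in $(\ell_0,t_{in},s_0)$ with probability $1$; from $c'$ with $\mathfrak S(c')=(g,\tilde s)$, $g\ne g_\bot$, the next configuration is $(\ell,t,s)$ with $t=(\ell_g,p,\tau,\eta,\ell)\in g$ with probability $p$ times the probability that $s$ results from $\tilde s$ by the update: temporary variables keep their value from $\tilde s$, $x\in\mathcal{PV}$ with $\eta(x)\in\mathbb Z[\mathcal V]$ becomes $\tilde s(\eta(x))$, and $x$ with $\eta(x)=d\in\mathcal D$ becomes $\tilde s(x)+v$ where $v$ is sampled from $d(\tilde s)$ (independently for each variable); if $g=g_\bot$ the next configuration is $(\ell_\bot,t_\bot,s)$ with probability $1$. This yields a probability $\mathbb P^{\mathfrak S}_{s_0}(f)$ of each finite path $f$ (product of these step probabilities), a probability measure on runs (cylinder construction) and an expectation operator $\mathbb E^{\mathfrak S}_{s_0}$. A finite path $f$ is admissible if $\mathbb P^{\mathfrak S}_{s_0}(f)>0$. Bounds: $\mathcal B$ is the smallest set containing $\mathcal{PV}\cup\overline{\mathbb R}_{\ge0}$ (with $\overline{\mathbb R}=\mathbb R\cup\{\infty\}$) and closed under $b_1+b_2$, $b_1\cdot b_2$, and $v^{b_1}$ for $v\in\mathbb R_{\ge1}$. A runtime bound is $\mathcal{RT}^\sqcap:\mathcal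 T\to\mathcal B$ with $|s_0|(\mathcal{RT}^\sqcap(t))\ge\sup\{|\{i\mid t_i=t\}|\mid f=(\_,t_0,\_)\cdots(\_,t_n,\_),\ \mathbb P^{\mathfrak S}_{s_0}(f)>0\}$ for all $t,\mathfrak S,s_0$; a size bound is $\mathcal{S}^\sqcap:\mathcal T\times\mathcal V\to\mathcal B$ with $|s_0|(\mathcal{S}^\sqcap(t,x))\ge\sup\{|s(x)|\mid f=\cdots(\_,t,s),\ \mathbb P^{\mathfrak S}_{s_0}(f)>0\}$ for all $t,x,\mathfrak S,s_0$ (with $\sup\emptyset=0$). For $g\in\mathcal{GT}$, the runtime random variable is $\mathcal R(g)((\_,t_0,\_)(\_,t_1,\_)\cdots)=|\{i\mid t_i\in g\}|$. General result variables: $\mathcal{GRV}=\{(g,\ell,x)\mid g\in\mathcal{GT},x\in\mathcal{PV},\ \ell \text{ is the target location of some } t\in g\}$; the size random variable is $\mathcal S(g,\ell,x)((\ell_0,t_0,s_0)(\ell_1,t_1,s_1)\cdots)=\sup\{|s_i(x)|\mid \ell_i=\ell,t_i\in g\}$. An expected runtime bound is $\mathcal{RT}_{\mathbb E}^\sqcap:\mathcal{GT}\to\mathcal B$ with $|s_0|(\mathcal{RT}_{\mathbb E}^\sqcap(g))\ge\mathbb E^{\mathfrak S}_{s_0}(\mathcal R(g))$ for all $g,\mathfrak S,s_0$; an expected size bound is $\mathcal{S}_{\mathbb E}^\sqcap:\mathcal{GRV}\to\mathcal B$ with $|s_0|(\mathcal{S}_{\mathbb E}^\sqcap(\alpha))\ge\mathbb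 E^{\mathfrak S}_{s_0}(\mathcal S(\alpha))$ for all $\alpha,\mathfrak S,s_0$. A pair of these is an expected bound pair. *)

theory Defs
  imports "HOL-Probability.Probability" "HOL-Library.Poly_Mapping"
begin

section \<open>States, integer polynomials and constraints\<close>

text \<open>The finite set of all variables is the type \<open>'v :: finite\<close>.\<close>

type_synonym 'v state = "'v \<Rightarrow> int"

definition abs_state :: "'v state \<Rightarrow> 'v state" where
  "abs_state s = (\<lambda>x. \<bar>s x\<bar>)"

type_synonym 'v zpoly = "('v \<Rightarrow>\<^sub>0 nat) \<Rightarrow>\<^sub>0 int"

definition poly_eval :: "'v zpoly \<Rightarrow> 'v state \<Rightarrow> int" where
  "poly_eval p s =
     (\<Sum>m\<in>Poly_Mapping.keys p. Poly_Mapping.lookup p m *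
        (\<Prod>x\<in>Poly_Mapping.keys m. s x ^ Poly_Mapping.lookup m x))"

text \<open>A list of pairs \<open>(e\<^sub>1, e\<^sub>2)\<close> is the conjunction of the inequalities \<open>e\<^sub>1 \<le> e\<^sub>2\<close>.\<close>

type_synonym 'v constraint = "('v zpoly \<times> 'v zpoly) list"

definition satisfies :: "'v state \<Rightarrow> 'v constraint \<Rightarrow> bool" where
  "satisfies s \<tau> \<longleftrightarrow> (\<forall>(e1, e2) \<in> set \<tau>. poly_eval e1 s \<le> poly_eval e2 s)"

definition dist_functions :: "('v state \<Rightarrow> int pmf) set" where
  "dist_functions = {d. \<forall>s. integrable (measure_pmf (d s)) real_of_int}"


section \<open>Probabilistic integer programs\<close>

datatype 'v update = PolyUpd "'v zpoly" | DistUpd "'v state \<Rightarrow> int pmf"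

text \<open>The update of a transition is a partial map whose domain is required to be the set of
  program variables, so that equality of transitions does not depend on irrelevant values.\<close>

datatype ('l, 'v) transition = Transition
  (src: 'l) (tprob: real) (guard: "'v constraint") (upd: "'v \<Rightarrow> 'v update option") (tgt: 'l)

type_synonym ('l, 'v) gen_transition = "('l, 'v) transition set"

record ('l, 'v) pip =
  pvars :: "'v set"
  locs :: "'l set"
  gts :: "('l, 'v) gen_transition set"
  initial :: 'l

definition transitions :: "('l, 'v) pip \<Rightarrow> ('l, 'v) transition set" where
  "transitions P = \<Union> (gts P)"

definition gsrc :: "('l, 'v) gen_transition \<Rightarrow> 'l" where
  "gsrc g = the_elem (src ` g)"

definition gguard :: "('l, 'v) gen_transition \<Rightarrow> 'v constraint" where
  "gguard g = the_elem (guard ` g)"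

definition wf_transition :: "('l, 'v) pip \<Rightarrow> ('l, 'v) transition \<Rightarrow> bool" where
  "wf_transition P t \<longleftrightarrow>
     src t \<in> locs P \<and> tgt t \<in> locs P \<and> tprob t \<ge> 0 \<and> dom (upd t) = pvars P \<and>
     (\<forall>x d. upd t x = Some (DistUpd d) \<longrightarrow> d \<in> dist_functions)"

definition wf_gen_transition :: "('l, 'v) pip \<Rightarrow> ('l, 'v) gen_transition \<Rightarrow> bool" where
  "wf_gen_transition P g \<longleftrightarrow>
     finite g \<and> g \<noteq> {} \<and> (\<forall>t\<in>g. wf_transition P t) \<and>
     (\<forall>t\<in>g. \<forall>t'\<in>g. src t = src t' \<and> guard t = guard t') \<and>
     (\<Sum>t\<in>g. tprob t) = 1"

definition is_pip :: "('l, 'v::finite) pip \<Rightarrow> bool" where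
  "is_pip P \<longleftrightarrow>
     finite (locs P) \<and> locs P \<noteq> {} \<and> initial P \<in> locs P \<and>
     finite (gts P) \<and> gts P \<noteq> {} \<and> (\<forall>g\<in>gts P. wf_gen_transition P g) \<and>
     (\<forall>t\<in>transitions P. tgt t \<noteq> initial P)"


section \<open>Configurations and schedulers\<close>

datatype 'l xloc = Loc 'l | LBot

datatype ('l, 'v) xtrans = Tr "('l, 'v) transition" | TIn | TBot

datatype ('l, 'v) xgen = Gen "('l, 'v) gen_transition" | GBot

type_synonym ('l, 'v) config = "'l xloc \<times> ('l, 'v) xtrans \<times> 'v state"

definition configs :: "('l, 'v) pip \<Rightarrow> ('l, 'v) config set" where
  "configs P = (Loc ` locs P \<union> {LBot}) \<times> (Tr ` transitions P \<union> {TIn, TBot}) \<times> UNIV"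

type_synonym ('l, 'v) sched = "('l, 'v) config \<Rightarrow> ('l, 'v) xgen \<times> 'v state"

definition choices ::
  "('l, 'v) pip \<Rightarrow> 'l xloc \<Rightarrow> 'v state \<Rightarrow> (('l, 'v) gen_transition \<times> 'v state) set" where
  "choices P l s =
     {(g, s'). g \<in> gts P \<and> (\<forall>x\<in>pvars P. s' x = s x) \<and> Loc (gsrc g) = l \<and> satisfies s' (gguard g)}"

definition is_scheduler :: "('l, 'v) pip \<Rightarrow> ('l, 'v) sched \<Rightarrow> bool" where
  "is_scheduler P S \<longleftrightarrow>
     (\<forall>(l, t, s) \<in> configs P.
        if l = LBot \<or> t = TBot \<or> choices P l s = {}
        then S (l, t, s) = (GBot, s)
        else (\<exists>(g, s') \<in> choices P l s. S (l, t, s) = (Gen g, s')))"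


section \<open>Semantics\<close>

definition trans_pmf :: "('l, 'v) gen_transition \<Rightarrow> ('l, 'v) transition pmf" where
  "trans_pmf g = embed_pmf (\<lambda>t. if t \<in> g then tprob t else 0)"

text \<open>The product distribution makes the samples for different variables independent.
  \<^const>\<open>None\<close> is the case of a temporary variable.\<close>

definition update_pmf :: "('l, 'v::finite) transition \<Rightarrow> 'v state \<Rightarrow> 'v state pmf" where
  "update_pmf t s = Pi_pmf UNIV 0 (\<lambda>x.
     case upd t x of
       None \<Rightarrow> return_pmf (s x)
     | Some (PolyUpd p) \<Rightarrow> return_pmf (poly_eval p s)
     | Some (DistUpd d) \<Rightarrow> map_pmf (\<lambda>v. s x + v) (d s))"

definition step_pmf :: "('l, 'v::finite) sched \<Rightarrow> ('l, 'v) config \<Rightarrow> ('l, 'v) config pmf" where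
  "step_pmf S c =
     (case S c of
        (GBot, s) \<Rightarrow> return_pmf (LBot, TBot, s)
      | (Gen g, s) \<Rightarrow>
          bind_pmf (trans_pmf g) (\<lambda>t. map_pmf (\<lambda>s'. (Loc (tgt t), Tr t, s')) (update_pmf t s)))"

definition init_config :: "('l, 'v) pip \<Rightarrow> 'v state \<Rightarrow> ('l, 'v) config" where
  "init_config P s0 = (Loc (initial P), TIn, s0)"

text \<open>Finite paths are nonempty lists of configurations.\<close>

definition path_prob ::
  "('l, 'v::finite) pip \<Rightarrow> ('l, 'v) sched \<Rightarrow> 'v state \<Rightarrow> ('l, 'v) config list \<Rightarrow> real" where
  "path_prob P S s0 f =
     (if f ! 0 = init_config P s0 then 1 else 0) *
     (\<Prod>i<length f - 1. pmf (step_pmf S (f ! i)) (f ! Suc i))"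

definition admissible ::
  "('l, 'v::finite) pip \<Rightarrow> ('l, 'v) sched \<Rightarrow> 'v state \<Rightarrow> ('l, 'v) config list \<Rightarrow> bool" where
  "admissible P S s0 f \<longleftrightarrow> f \<noteq> [] \<and> path_prob P S s0 f > 0"

text \<open>The measure on runs is obtained from the step distributions by the Ionescu-Tulcea theorem;
  \<open>emeasure_cylinder\<close> below relates it to \<^const>\<open>path_prob\<close>. The type of configurations
  is uncountable, but all step distributions are discrete, so each component of a run carries the
  discrete sigma-algebra.\<close>

type_synonym ('l, 'v) run = "nat \<Rightarrow> ('l, 'v) config"

definition run_kernel ::
  "('l, 'v::finite) pip \<Rightarrow> ('l, 'v) sched \<Rightarrow> 'v state \<Rightarrow>
     nat \<Rightarrow> ('l, 'v) run \<Rightarrow> ('l, 'v) config measure" where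
  "run_kernel P S s0 n r =
     measure_pmf (case n of 0 \<Rightarrow> return_pmf (init_config P s0) | Suc m \<Rightarrow> step_pmf S (r m))"

definition run_measure ::
  "('l, 'v::finite) pip \<Rightarrow> ('l, 'v) sched \<Rightarrow> 'v state \<Rightarrow> ('l, 'v) run measure" where
  "run_measure P S s0 =
     projective_family.lim UNIV
       (Ionescu_Tulcea.CI (run_kernel P S s0) (\<lambda>_. count_space UNIV)) (\<lambda>_. count_space UNIV)"


section \<open>Bounds\<close>

text \<open>A bound is identified with the function that evaluates it, so that the finite sum of bounds
  is again a bound independently of the order of summation. Bounds are only evaluated at states
  \<open>\<bar>s\<bar>\<close>, where the truncation of negative values by \<^const>\<open>ennreal\<close> plays no role.
  In type \<^typ>\<open>ennreal\<close>, \<open>0 * \<infinity> = 0\<close>.\<close>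

type_synonym 'v bound = "'v state \<Rightarrow> ennreal"

definition ennpow :: "real \<Rightarrow> ennreal \<Rightarrow> ennreal" where
  "ennpow v b =
     (if b = \<infinity> then (if v = 1 then 1 else \<infinity>) else ennreal (v powr enn2real b))"

inductive_set bounds :: "'v set \<Rightarrow> 'v bound set" for PV :: "'v set" where
  var: "x \<in> PV \<Longrightarrow> (\<lambda>\<sigma>. ennreal (real_of_int (\<sigma> x))) \<in> bounds PV"
| const: "(\<lambda>\<sigma>. c) \<in> bounds PV"
| add: "b1 \<in> bounds PV \<Longrightarrow> b2 \<in> bounds PV \<Longrightarrow> (\<lambda>\<sigma>. b1 \<sigma> + b2 \<sigma>) \<in> bounds PV"
| mult: "b1 \<in> bounds PV \<Longrightarrow> b2 \<in> bounds PV \<Longrightarrow> (\<lambda>\<sigma>. b1 \<sigma> * b2 \<sigma>) \<in> bounds PV"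
| exp: "b \<in> bounds PV \<Longrightarrow> v \<ge> 1 \<Longrightarrow> (\<lambda>\<sigma>. ennpow v (b \<sigma>)) \<in> bounds PV"

definition runtime_bound ::
  "('l, 'v::finite) pip \<Rightarrow> (('l, 'v) transition \<Rightarrow> 'v bound) \<Rightarrow> bool" where
  "runtime_bound P RT \<longleftrightarrow>
     (\<forall>t\<in>transitions P. RT t \<in> bounds (pvars P) \<and>
        (\<forall>S s0. is_scheduler P S \<longrightarrow>
           RT t (abs_state s0) \<ge>
             Sup {of_nat (card {i. i < length f \<and> fst (snd (f ! i)) = Tr t}) | f.
                    admissible P S s0 f}))"

definition size_bound ::
  "('l, 'v::finite) pip \<Rightarrow> (('l, 'v) transition \<times> 'v \<Rightarrow> 'v bound) \<Rightarrow> bool" where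
  "size_bound P SB \<longleftrightarrow>
     (\<forall>t\<in>transitions P. \<forall>x. SB (t, x) \<in> bounds (pvars P) \<and>
        (\<forall>S s0. is_scheduler P S \<longrightarrow>
           SB (t, x) (abs_state s0) \<ge>
             Sup {ennreal (real_of_int \<bar>s x\<bar>) | f l s.
                    admissible P S s0 f \<and> last f = (l, Tr t, s)}))"

text \<open>The counting measure is the cardinality with values in \<open>\<nat> \<union> {\<infinity>}\<close>.\<close>

definition runtime_rv :: "('l, 'v) gen_transition \<Rightarrow> ('l, 'v) run \<Rightarrow> ennreal" where
  "runtime_rv g r = emeasure (count_space UNIV) {i. fst (snd (r i)) \<in> Tr ` g}"

type_synonym ('l, 'v) result_var = "('l, 'v) gen_transition \<times> 'l \<times> 'v"

definition GRV :: "('l, 'v) pip \<Rightarrow> ('l, 'v) result_var set" where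
  "GRV P = {(g, l, x). g \<in> gts P \<and> x \<in> pvars P \<and> l \<in> tgt ` g}"

definition size_rv :: "('l, 'v) result_var \<Rightarrow> ('l, 'v) run \<Rightarrow> ennreal" where
  "size_rv \<alpha> r = (case \<alpha> of (g, l, x) \<Rightarrow>
     Sup {ennreal (real_of_int \<bar>snd (snd (r i)) x\<bar>) | i.
            fst (r i) = Loc l \<and> fst (snd (r i)) \<in> Tr ` g})"

definition expected_runtime_bound ::
  "('l, 'v::finite) pip \<Rightarrow> (('l, 'v) gen_transition \<Rightarrow> 'v bound) \<Rightarrow> bool" where
  "expected_runtime_bound P RTE \<longleftrightarrow>
     (\<forall>g\<in>gts P. RTE g \<in> bounds (pvars P) \<and>
        (\<forall>S s0. is_scheduler P S \<longrightarrow>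
           RTE g (abs_state s0) \<ge> (\<integral>\<^sup>+ r. runtime_rv g r \<partial>run_measure P S s0)))"

definition expected_size_bound ::
  "('l, 'v::finite) pip \<Rightarrow> (('l, 'v) result_var \<Rightarrow> 'v bound) \<Rightarrow> bool" where
  "expected_size_bound P SE \<longleftrightarrow>
     (\<forall>\<alpha>\<in>GRV P. SE \<alpha> \<in> bounds (pvars P) \<and>
        (\<forall>S s0. is_scheduler P S \<longrightarrow>
           SE \<alpha> (abs_state s0) \<ge> (\<integral>\<^sup>+ r. size_rv \<alpha> r \<partial>run_measure P S s0)))"

definition expected_bound_pair ::
  "('l, 'v::finite) pip \<Rightarrow> (('l, 'v) gen_transition \<Rightarrow> 'v bound) \<Rightarrow>
     (('l, 'v) result_var \<Rightarrow> 'v bound) \<Rightarrow> bool" where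
  "expected_bound_pair P RTE SE \<longleftrightarrow> expected_runtime_bound P RTE \<and> expected_size_bound P SE"


section \<open>Adequacy of the semantics\<close>

lemma pmf_trans_pmf:
  assumes "wf_gen_transition P g"
  shows "pmf (trans_pmf g) t = (if t \<in> g then tprob t else 0)"
proof -
  have fin: "finite g" and nn: "\<And>t. t \<in> g \<Longrightarrow> tprob t \<ge> 0" and one: "(\<Sum>t\<in>g. tprob t) = 1"
    using assms by (auto simp: wf_gen_transition_def wf_transition_def)
  have "(\<integral>\<^sup>+ t. ennreal (if t \<in> g then tprob t else 0) \<partial>count_space UNIV) =
        (\<Sum>t\<in>g. ennreal (tprob t))"
    by (subst nn_integral_count_space'[OF fin]) auto
  also have "\<dots> = 1"
    using nn one by (subst sum_ennreal) auto
  finally show ?thesis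
    unfolding trans_pmf_def by (subst pmf_embed_pmf) (use nn in auto)
qed

lemma pmf_step_pmf:
  fixes S :: "('l, 'v::finite) sched"
  assumes "wf_gen_transition P g" "S c = (Gen g, s)" "t \<in> g"
  shows "pmf (step_pmf S c) (Loc (tgt t), Tr t, s') =
    tprob t * (\<Prod>x\<in>UNIV. case upd t x of
        None \<Rightarrow> if s' x = s x then 1 else 0
      | Some (PolyUpd p) \<Rightarrow> if s' x = poly_eval p s then 1 else 0
      | Some (DistUpd d) \<Rightarrow> pmf (d s) (s' x - s x))"
proof -
  have inj: "inj (\<lambda>s'. (Loc (tgt u), Tr u, s' :: 'v state))" for u :: "('l, 'v) transition"
    by (auto simp: inj_def)
  have eq: "pmf (map_pmf (\<lambda>s'. (Loc (tgt u), Tr u, s')) (update_pmf u s)) (Loc (tgt t), Tr t, s') =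
        pmf (update_pmf t s) s' * indicator {t} u" for u
    using pmf_map_inj'[OF inj[of t]]
    by (cases "u = t") (auto simp: pmf_eq_0_set_pmf)
  have "pmf (step_pmf S c) (Loc (tgt t), Tr t, s') =
        measure_pmf.expectation (trans_pmf g) (\<lambda>u. pmf (update_pmf t s) s' * indicator {t} u)"
    by (simp add: step_pmf_def assms(2) pmf_bind eq)
  also have "\<dots> = tprob t * pmf (update_pmf t s) s'"
    using pmf_trans_pmf[OF assms(1), of t] assms(3) by (simp add: measure_pmf_single)
  also have "pmf (update_pmf t s) s' = (\<Prod>x\<in>UNIV. case upd t x of
        None \<Rightarrow> if s' x = s x then 1 else 0
      | Some (PolyUpd p) \<Rightarrow> if s' x = poly_eval p s then 1 else 0
      | Some (DistUpd d) \<Rightarrow> pmf (d s) (s' x - s x))"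
  proof -
    have "pmf (map_pmf (\<lambda>v. a + v) D) y = pmf D (y - a)" for a y :: int and D
      using pmf_map_inj'[of "\<lambda>v. a + v" D "y - a"] by (simp add: inj_def)
    then show ?thesis
      unfolding update_pmf_def
      by (subst pmf_Pi') (auto intro!: prod.cong simp: indicator_def split: option.split update.split)
  qed
  finally show ?thesis .
qed

lemma Ionescu_Tulcea_run_kernel:
  fixes P :: "('l, 'v::finite) pip"
  shows "Ionescu_Tulcea (run_kernel P S s0) (\<lambda>_. count_space UNIV)"
proof (rule Ionescu_Tulcea.intro)
  let ?M = "\<lambda>_::nat. count_space (UNIV :: ('l, 'v) config set)"
  show "run_kernel P S s0 i \<in> measurable (PiM {0..<i} ?M) (subprob_algebra (?M i))" for i
  proof (cases i)
    case 0
    have "run_kernel P S s0 0 = (\<lambda>_. measure_pmf (return_pmf (init_config P s0)))"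
      by (simp only: run_kernel_def[abs_def] nat.case)
    with 0 show ?thesis
      by (simp only: measurable_const measure_pmf_in_subprob_algebra)
  next
    case (Suc m)
    have "(\<lambda>c. measure_pmf (step_pmf S c)) \<in> measurable (?M m) (subprob_algebra (?M i))"
      by (simp only: measurable_count_space_eq1 Pi_iff)
        (simp add: measure_pmf_in_subprob_algebra)
    then have "(\<lambda>r. measure_pmf (step_pmf S (r m))) \<in>
        measurable (PiM {0..<i} ?M) (subprob_algebra (?M i))"
      by (rule measurable_compose[rotated])
        (rule measurable_component_singleton, simp add: Suc)
    moreover have "run_kernel P S s0 (Suc m) = (\<lambda>r. measure_pmf (step_pmf S (r m)))"
      by (simp only: run_kernel_def[abs_def] nat.case)
    ultimately show ?thesis
      by (simp only: Suc)
  qed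
  show "prob_space (run_kernel P S s0 i r)" for i r
    unfolding run_kernel_def by (rule prob_space_measure_pmf)
qed

lemma sets_run_measure: "sets (run_measure P S s0) = sets (PiM UNIV (\<lambda>_. count_space UNIV))"
proof -
  interpret Ionescu_Tulcea "run_kernel P S s0" "\<lambda>_. count_space UNIV"
    by (rule Ionescu_Tulcea_run_kernel)
  show ?thesis
    unfolding run_measure_def by (rule PF.sets_lim)
qed

lemma emeasure_cylinder_prod:
  "emeasure (run_measure P S s0) {r. \<forall>i<n. r i = w i} =
     (\<Prod>i<n. emeasure (run_kernel P S s0 i w) {w i})"
proof -
  let ?M = "\<lambda>_::nat. count_space (UNIV :: ('a, 'b) config set)"
  let ?K = "run_kernel P S s0"
  interpret Ionescu_Tulcea ?K ?M
    by (rule Ionescu_Tulcea_run_kernel)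
  define X where "X m = PiE {0..<m} (\<lambda>i. {w i})" for m
  have sX[measurable]: "X m \<in> sets (PiM {0..<m} ?M)" for m
    unfolding X_def by (intro sets_PiM_I_finite) auto
  have u: "(\<lambda>_. undefined) \<in> space (PiM {0..<0} ?M)"
    by (auto simp: space_PiM)
  have C: "emeasure (C 0 m (\<lambda>_. undefined)) (X m) = (\<Prod>i<m. emeasure (?K i w) {w i})" for m
  proof (induction m)
    case 0
    show ?case
      using sX[of 0] by (simp add: emeasure_return) (simp add: X_def)
  next
    case (Suc m)
    have sp: "space (C 0 m (\<lambda>_. undefined)) = space (PiM {0..<m} ?M)"
      using space_C[OF u, of m] by simp
    have se: "sets (C 0 m (\<lambda>_. undefined)) = sets (PiM {0..<m} ?M)"
      using sets_C[OF u, of m] by simp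
    have ne: "space (C 0 m (\<lambda>_. undefined)) \<noteq> {}"
      unfolding sp by (simp add: space_PiM PiE_eq_empty_iff)
    have meas: "eP m \<in> measurable (C 0 m (\<lambda>_. undefined)) (subprob_algebra (PiM {0..<Suc m} ?M))"
      using measurable_eP[of m] by (simp add: measurable_cong_sets[OF se refl])
    have eq: "emeasure (eP m x) (X (Suc m)) = emeasure (?K m w) {w m} * indicator (X m) x"
      if x: "x \<in> space (PiM {0..<m} ?M)" for x
    proof -
      have "emeasure (eP m x) (X (Suc m)) = emeasure (?K m x) ((\<lambda>y. x(m := y)) -` X (Suc m))"
        by (subst emeasure_eP[OF x sX]) simp
      also have "\<dots> = emeasure (?K m w) {w m} * indicator (X m) x"
      proof (cases "x \<in> X m")
        case True
        then have "(\<lambda>y. x(m := y)) -` X (Suc m) = {w m}"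
          by (auto simp: X_def PiE_iff extensional_def less_Suc_eq split: if_splits)
        moreover have "?K m x = ?K m w"
          using True by (auto simp: run_kernel_def X_def PiE_iff split: nat.split)
        ultimately show ?thesis
          using True by simp
      next
        case False
        have "x(m := y) \<notin> X (Suc m)" for y
        proof
          assume *: "x(m := y) \<in> X (Suc m)"
          have "x i = w i" if "i < m" for i
            using PiE_mem[OF *[unfolded X_def], of i] that by simp
          with x False show False
            by (auto simp: X_def PiE_iff space_PiM)
        qed
        then have "(\<lambda>y. x(m := y)) -` X (Suc m) = {}"
          by auto
        with False show ?thesis
          by simp
      qed
      finally show ?thesis .
    qed
    have "emeasure (C 0 (Suc m) (\<lambda>_. undefined)) (X (Suc m)) =
        (\<integral>\<^sup>+ x. emeasure (eP m x) (X (Suc m)) \<partial>C 0 m (\<lambda>_. undefined))"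
      using emeasure_bind[OF ne meas sX] by simp
    also have "\<dots> = (\<integral>\<^sup>+ x. emeasure (?K m w) {w m} * indicator (X m) x \<partial>C 0 m (\<lambda>_. undefined))"
      by (intro nn_integral_cong eq) (simp add: sp)
    also have "\<dots> = emeasure (?K m w) {w m} * emeasure (C 0 m (\<lambda>_. undefined)) (X m)"
      by (subst nn_integral_cmult_indicator) (auto simp: se)
    finally show ?case
      by (simp only: Suc.IH prod.lessThan_Suc mult.commute)
  qed
  have emb: "prod_emb UNIV ?M {0..<n} (X n) = {r. \<forall>i<n. r i = w i}"
    unfolding X_def by (subst prod_emb_PiE) (auto simp: PiE_iff split: if_splits)
  have self: "prod_emb {0..<n} ?M {0..<n} (X n) = X n"
    using sets.sets_into_space[OF sX[of n]] by (simp add: prod_emb_id space_PiM)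
  have "emeasure (run_measure P S s0) {r. \<forall>i<n. r i = w i} = emeasure (CI {0..<n}) (X n)"
    using lim[OF _ sX[of n]] by (simp add: run_measure_def emb)
  also have "\<dots> = emeasure (C 0 n (\<lambda>_. undefined)) (X n)"
    using emeasure_CI[OF order.refl sX[of n]] by (simp add: self)
  finally show ?thesis
    unfolding C .
qed

lemma prob_space_run_measure: "prob_space (run_measure P S s0)"
proof
  have "space (run_measure P S s0) = UNIV"
    using sets_eq_imp_space_eq[OF sets_run_measure[of P S s0]] by (simp add: space_PiM)
  then show "emeasure (run_measure P S s0) (space (run_measure P S s0)) = 1"
    using emeasure_cylinder_prod[of P S s0 0] by simp
qed

lemma emeasure_cylinder:
  assumes "f \<noteq> []"
  shows "emeasure (run_measure P S s0) {r. \<forall>i<length f. r i = f ! i} = ennreal (path_prob P S s0 f)"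
proof -
  obtain n where n: "length f = Suc n"
    using assms by (cases f) auto
  have "(\<Prod>i<Suc n. emeasure (run_kernel P S s0 i ((!) f)) {f ! i}) =
      emeasure (run_kernel P S s0 0 ((!) f)) {f ! 0} *
      (\<Prod>i<n. emeasure (run_kernel P S s0 (Suc i) ((!) f)) {f ! Suc i})"
    by (rule prod.lessThan_Suc_shift)
  also have "emeasure (run_kernel P S s0 0 ((!) f)) {f ! 0} =
      ennreal (if f ! 0 = init_config P s0 then 1 else 0)"
    by (simp add: run_kernel_def emeasure_pmf_single)
  also have "(\<Prod>i<n. emeasure (run_kernel P S s0 (Suc i) ((!) f)) {f ! Suc i}) =
      ennreal (\<Prod>i<n. pmf (step_pmf S (f ! i)) (f ! Suc i))"
    by (subst prod_ennreal[symmetric]) (simp_all add: run_kernel_def emeasure_pmf_single)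
  also have "ennreal (if f ! 0 = init_config P s0 then 1 else 0) *
      ennreal (\<Prod>i<n. pmf (step_pmf S (f ! i)) (f ! Suc i)) = ennreal (path_prob P S s0 f)"
    by (simp add: path_prob_def n)
  finally show ?thesis
    by (simp only: emeasure_cylinder_prod n)
qed

lemma measurable_run_component:
  "(\<lambda>r. h (r i)) \<in> borel_measurable (run_measure P S s0)" for h :: "_ \<Rightarrow> ennreal"
proof -
  have "(\<lambda>r. r i) \<in> measurable (run_measure P S s0) (count_space UNIV)"
    using measurable_component_singleton[of i UNIV "\<lambda>_. count_space UNIV"]
    by (simp add: measurable_cong_sets[OF sets_run_measure refl])
  then show ?thesis
    by (rule measurable_compose) simp
qed

lemma measurable_runtime_rv: "runtime_rv g \<in> borel_measurable (run_measure P S s0)"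
proof -
  have "runtime_rv g r = suminf (\<lambda>i. indicator {c. fst (snd c) \<in> Tr ` g} (r i))" for r
    unfolding runtime_rv_def
    by (subst nn_integral_indicator[symmetric], simp, subst nn_integral_count_space_nat)
      (auto intro!: suminf_cong simp: indicator_def)
  then have eq: "runtime_rv g = (\<lambda>r. suminf (\<lambda>i. indicator {c. fst (snd c) \<in> Tr ` g} (r i)))"
    by (rule ext)
  show ?thesis
    unfolding eq by (intro borel_measurable_suminf_order measurable_run_component)
qed

lemma measurable_size_rv: "size_rv \<alpha> \<in> borel_measurable (run_measure P S s0)"
proof (cases \<alpha>)
  case (fields g l x)
  define h :: "('a, 'b) config \<Rightarrow> ennreal"
    where "h c = (if fst c = Loc l \<and> fst (snd c) \<in> Tr ` g
                  then ennreal (real_of_int \<bar>snd (snd c) x\<bar>) else 0)" for c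
  have "size_rv \<alpha> r = (SUP i. h (r i))" for r
  proof (rule antisym)
    show "size_rv \<alpha> r \<le> (SUP i. h (r i))"
      unfolding size_rv_def fields prod.case
    proof (rule Sup_least)
      fix y
      assume "y \<in> {ennreal (real_of_int \<bar>snd (snd (r i)) x\<bar>) | i.
                      fst (r i) = Loc l \<and> fst (snd (r i)) \<in> Tr ` g}"
      then obtain i where "fst (r i) = Loc l" "fst (snd (r i)) \<in> Tr ` g"
        "y = ennreal (real_of_int \<bar>snd (snd (r i)) x\<bar>)"
        by blast
      then have "y = h (r i)"
        by (simp add: h_def)
      then show "y \<le> (SUP i. h (r i))"
        by (simp only:) (rule SUP_upper, rule UNIV_I)
    qed
    have "h (r i) \<le> size_rv \<alpha> r" for i
    proof (cases "fst (r i) = Loc l \<and> fst (snd (r i)) \<in> Tr ` g")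
      case True
      then have "ennreal (real_of_int \<bar>snd (snd (r i)) x\<bar>) \<le> size_rv \<alpha> r"
        unfolding size_rv_def fields prod.case by (intro Sup_upper) blast
      with True show ?thesis
        by (simp add: h_def)
    next
      case False
      then have "h (r i) = 0"
        unfolding h_def by (rule if_not_P)
      then show ?thesis
        by simp
    qed
    then show "(SUP i. h (r i)) \<le> size_rv \<alpha> r"
      by (rule SUP_least)
  qed
  moreover have "(\<lambda>r. SUP i. h (r i)) \<in> borel_measurable (run_measure P S s0)"
    by (rule borel_measurable_SUP[OF countableI_type measurable_run_component])
  ultimately show ?thesis
    by (simp cong: measurable_cong)
qed

end

theory Submission
  imports Defs
begin

text \<open>Almost every run has only admissible prefixes: the admissible paths of a fixed length are the
  support of a discrete distribution, and their countably many cylinders therefore carry total mass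
  one. On such a run the runtime and size variables are bounded pointwise by the sums of the
  classical bounds, because the visits to \<open>g\<close> split into the visits to its finitely many
  transitions, and a transition always leads to its own target location.\<close>

lemma sum_in_bounds:
  assumes "\<And>a. a \<in> A \<Longrightarrow> f a \<in> bounds PV"
  shows "(\<lambda>\<sigma>. \<Sum>a\<in>A. f a \<sigma>) \<in> bounds PV"
  using assms
proof (induction A rule: infinite_finite_induct)
  case (insert a A)
  then show ?case
    using bounds.add[of "f a" PV "\<lambda>\<sigma>. \<Sum>a\<in>A. f a \<sigma>"] by simp
\<comment> \<open>An empty or infinite index set yields the constant 0, which
  \<open>bounds.const\<close> covers.\<close>
qed (auto intro: bounds.const)

text \<open>Runtime bounds speak of finite paths only. The visits among the first \<open>n\<close>
  positions increase to the possibly infinite set of all visits, so continuity from below carries a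
  uniform bound over to the limit.\<close>

lemma emeasure_count_space_le:
  fixes A :: "nat set"
  assumes "\<And>n. of_nat (card {i. i < n \<and> i \<in> A}) \<le> b"
  shows "emeasure (count_space UNIV) A \<le> b"
proof -
  have "incseq (\<lambda>n. {i. i < n \<and> i \<in> A})"
    by (auto simp: incseq_def)
  then have "(SUP n. emeasure (count_space UNIV) {i. i < n \<and> i \<in> A}) =
      emeasure (count_space UNIV) (\<Union>n. {i. i < n \<and> i \<in> A})"
    by (intro SUP_emeasure_incseq) auto
  also have "(\<Union>n. {i. i < n \<and> i \<in> A}) = A"
    by auto
  finally have "emeasure (count_space UNIV) A =
      (SUP n. emeasure (count_space UNIV) {i. i < n \<and> i \<in> A})"
    by simp
  also have "\<dots> \<le> b"
    using assms by (intro SUP_least) (simp add: emeasure_count_space_finite)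
  finally show ?thesis .
qed

text \<open>Paths with \<open>n\<close> steps, hence \<open>n + 1\<close> configurations. There are
  uncountably many lists of configurations; building the distribution as a pmf provides a countable
  support, as countable additivity requires.\<close>

primrec path_pmf ::
  "('l, 'v::finite) pip \<Rightarrow> ('l, 'v) sched \<Rightarrow> 'v state \<Rightarrow> nat \<Rightarrow> ('l, 'v) config list pmf" where
  "path_pmf P S s0 0 = return_pmf [init_config P s0]"
| "path_pmf P S s0 (Suc n) =
     bind_pmf (path_pmf P S s0 n) (\<lambda>f. map_pmf (\<lambda>c. f @ [c]) (step_pmf S (last f)))"

lemma length_path_pmf: "f \<in> set_pmf (path_pmf P S s0 n) \<Longrightarrow> length f = Suc n"
  by (induction n arbitrary: f) auto

lemma path_prob_snoc:
  assumes "f \<noteq> []"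
  shows "path_prob P S s0 (f @ [c]) = path_prob P S s0 f * pmf (step_pmf S (last f)) c"
proof -
  obtain n where n: "length f = Suc n"
    using assms by (cases f) auto
  then show ?thesis
    using assms by (simp add: path_prob_def nth_append last_conv_nth)
qed

lemma pmf_path_pmf:
  "length f = Suc n \<Longrightarrow> pmf (path_pmf P S s0 n) f = path_prob P S s0 f"
proof (induction n arbitrary: f)
  case 0
  then show ?case
    by (auto simp: length_Suc_conv path_prob_def indicator_def)
next
  case (Suc n)
  then obtain g c where f: "f = g @ [c]" and g: "length g = Suc n"
    by (metis length_Suc_conv_rev)
  \<comment> \<open>Appending is injective, so only the prefix \<open>g\<close> contributes, and the
    integral of the bind collapses to a single point mass.\<close>
  have eq: "pmf (map_pmf (\<lambda>c. h @ [c]) (step_pmf S (last h))) (g @ [c]) =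
      pmf (step_pmf S (last g)) c * indicator {g} h" for h
  proof (cases "h = g")
    case True
    then show ?thesis
      using pmf_map_inj'[of "\<lambda>c. g @ [c]" "step_pmf S (last g)" c] by (simp add: inj_def)
  next
    case False
    then show ?thesis
      by (auto simp: pmf_eq_0_set_pmf)
  qed
  have "pmf (path_pmf P S s0 (Suc n)) f = pmf (step_pmf S (last g)) c * pmf (path_pmf P S s0 n) g"
    by (simp add: f pmf_bind eq measure_pmf_single)
  with Suc.IH[OF g] g show ?case
    by (subst f, subst path_prob_snoc) auto
qed

lemma measurable_cylinder: "{r. \<forall>i<n. r i = w i} \<in> sets (run_measure P S s0)"
proof -
  have "{r. \<forall>i<n. r i = w i} =
      prod_emb UNIV (\<lambda>_. count_space UNIV) {..<n} (PiE {..<n} (\<lambda>i. {w i}))"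
    by (subst prod_emb_PiE) (auto simp: PiE_iff split: if_splits)
  also have "\<dots> \<in> sets (PiM UNIV (\<lambda>_. count_space UNIV))"
    by (intro sets_PiM_I) auto
  finally show ?thesis
    by (simp add: sets_run_measure)
qed

text \<open>This makes the classical bounds, which quantify over admissible finite paths, applicable
  along a run. Prefixes have length \<open>Suc n\<close> because the empty list is never
  admissible.\<close>

lemma AE_prefix_admissible:
  "AE r in run_measure P S s0. \<forall>n. admissible P S s0 (map r [0..<Suc n])"
  unfolding AE_all_countable
proof
  fix n
  let ?M = "run_measure P S s0" and ?p = "path_pmf P S s0 n"
  interpret prob_space ?M
    by (rule prob_space_run_measure)
  define cyl where "cyl f = {r. \<forall>i<length f. r i = f ! i}" for f :: "('a, 'b) config list"
  have cyl: "cyl f \<in> sets ?M" for f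
    unfolding cyl_def by (rule measurable_cylinder)
  \<comment> \<open>All paths in the support have the same length, so two of them sharing a run
    agree everywhere.\<close>
  have "disjoint_family_on cyl (set_pmf ?p)"
    unfolding disjoint_family_on_def cyl_def
    by (auto dest!: length_path_pmf intro!: nth_equalityI)
  then have "emeasure ?M (\<Union>f\<in>set_pmf ?p. cyl f) =
      (\<integral>\<^sup>+f. emeasure ?M (cyl f) \<partial>count_space (set_pmf ?p))"
    by (intro emeasure_UN_countable) (auto simp: cyl)
  also have "\<dots> = (\<integral>\<^sup>+f. ennreal (pmf ?p f) \<partial>count_space (set_pmf ?p))"
  proof (intro nn_integral_cong)
    fix f assume "f \<in> space (count_space (set_pmf ?p))"
    then have l: "length f = Suc n"
      by (simp add: length_path_pmf)
    then have "f \<noteq> []"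
      by auto
    then show "emeasure ?M (cyl f) = ennreal (pmf ?p f)"
      unfolding cyl_def pmf_path_pmf[OF l] by (rule emeasure_cylinder)
  qed
  \<comment> \<open>The point masses over the support add up to the mass that \<open>?p\<close>
    gives to its own support.\<close>
  also have "\<dots> = 1"
    by (simp add: nn_integral_pmf measure_pmf.emeasure_eq_measure measure_pmf.prob_eq_1 AE_measure_pmf)
  finally have "AE r in ?M. r \<in> (\<Union>f\<in>set_pmf ?p. cyl f)"
    using cyl by (subst AE_in_set_eq_1) (auto simp: measure_def intro!: sets.countable_UN')
  then show "AE r in ?M. admissible P S s0 (map r [0..<Suc n])"
  proof (rule AE_mp, intro AE_I2 impI)
    fix r assume "r \<in> (\<Union>f\<in>set_pmf ?p. cyl f)"
    then obtain f where f: "f \<in> set_pmf ?p" and r: "\<And>i. i < length f \<Longrightarrow> r i = f ! i"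
      by (auto simp: cyl_def)
    have l: "length f = Suc n"
      using f by (rule length_path_pmf)
    have "map r [0..<Suc n] = f"
      by (rule nth_equalityI) (auto simp: l r simp del: upt_Suc)
    moreover have "f \<noteq> []"
      using l by auto
    moreover have "path_prob P S s0 f > 0"
      using f l by (metis pmf_path_pmf pmf_positive)
    ultimately show "admissible P S s0 (map r [0..<Suc n])"
      by (simp add: admissible_def)
  qed
qed

lemma step_target: "(l, Tr t, s) \<in> set_pmf (step_pmf S c) \<Longrightarrow> l = Loc (tgt t)"
  by (auto simp: step_pmf_def split: prod.splits xgen.splits)

text \<open>Links the location test in \<open>size_rv\<close> to the index set of the size sum,
  which selects transitions by their target.\<close>

lemma admissible_prefix_target:
  assumes "admissible P S s0 (map r [0..<Suc n])" and "r n = (l, Tr t, s)"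
  shows "l = Loc (tgt t)"
proof (cases n)
  \<comment> \<open>The initial configuration carries \<open>TIn\<close>, so no \<open>Tr t\<close>
    can occur at position 0.\<close>
  case 0
  with assms show ?thesis
    by (auto simp: admissible_def path_prob_def init_config_def split: if_splits)
next
  case (Suc m)
  have "map r [0..<Suc n] = map r [0..<Suc m] @ [r n]"
    by (simp add: Suc)
  then have "path_prob P S s0 (map r [0..<Suc n]) =
      path_prob P S s0 (map r [0..<Suc m]) * pmf (step_pmf S (r m)) (r n)"
    by (simp only:) (subst path_prob_snoc, auto)
  \<comment> \<open>A positive product has no zero factor, so the last step has positive
    probability.\<close>
  with assms(1) have "r n \<in> set_pmf (step_pmf S (r m))"
    by (auto simp: admissible_def set_pmf_iff simp del: upt_Suc)
  with assms(2) show ?thesis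
    using step_target by fastforce
qed

lemma runtime_rv_le:
  assumes P: "finite g" "g \<subseteq> transitions P" and RT: "runtime_bound P RT" and S: "is_scheduler P S"
    and r: "\<And>n. admissible P S s0 (map r [0..<Suc n])"
  shows "runtime_rv g r \<le> (\<Sum>t\<in>g. RT t (abs_state s0))"
proof -
  have "{i. fst (snd (r i)) \<in> Tr ` g} = (\<Union>t\<in>g. {i. fst (snd (r i)) = Tr t})"
    by auto
  then have "runtime_rv g r \<le> (\<Sum>t\<in>g. emeasure (count_space UNIV) {i. fst (snd (r i)) = Tr t})"
    unfolding runtime_rv_def
    by (simp only:) (rule emeasure_subadditive_finite, auto simp: P)
  also have "\<dots> \<le> (\<Sum>t\<in>g. RT t (abs_state s0))"
  proof (intro sum_mono emeasure_count_space_le)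
    fix t n assume "t \<in> g"
    \<comment> \<open>One configuration more than the count needs: for \<open>n = 0\<close> the
      shorter prefix would be empty, and the extra position can only raise the count.\<close>
    let ?f = "map r [0..<Suc n]"
    have le: "of_nat (card {i. i < length ?f \<and> fst (snd (?f ! i)) = Tr t}) \<le> RT t (abs_state s0)"
    proof (rule order_trans[OF Sup_upper])
      show "Sup {of_nat (card {i. i < length f \<and> fst (snd (f ! i)) = Tr t}) | f.
          admissible P S s0 f} \<le> RT t (abs_state s0)"
        using RT S \<open>t \<in> g\<close> P(2) by (auto simp: runtime_bound_def)
    qed (use r in blast)
    have "card {i. i < n \<and> i \<in> {i. fst (snd (r i)) = Tr t}} \<le>
        card {i. i < length ?f \<and> fst (snd (?f ! i)) = Tr t}"
      by (intro card_mono) (auto simp del: upt_Suc)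
    then show "of_nat (card {i. i < n \<and> i \<in> {i. fst (snd (r i)) = Tr t}}) \<le> RT t (abs_state s0)"
      by (intro order_trans[OF _ le] of_nat_mono)
  qed
  finally show ?thesis .
qed

text \<open>Each value under the supremum is bounded by the summand of the transition that produced
  it, and the other summands are nonnegative.\<close>

lemma size_rv_le:
  assumes P: "finite g" "g \<subseteq> transitions P" and SB: "size_bound P SB" and S: "is_scheduler P S"
    and r: "\<And>n. admissible P S s0 (map r [0..<Suc n])"
  shows "size_rv (g, l, x) r \<le> (\<Sum>t\<in>{t \<in> g. tgt t = l}. SB (t, x) (abs_state s0))"
  unfolding size_rv_def prod.case
proof (rule Sup_least)
  fix y
  assume "y \<in> {ennreal (real_of_int \<bar>snd (snd (r i)) x\<bar>) | i.
                 fst (r i) = Loc l \<and> fst (snd (r i)) \<in> Tr ` g}"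
  then obtain i t s where i: "r i = (Loc l, Tr t, s)" and t: "t \<in> g"
    and y: "y = ennreal (real_of_int \<bar>s x\<bar>)"
    by (force simp: prod_eq_iff)
  have "tgt t = l"
    using admissible_prefix_target[OF r i] by simp
  \<comment> \<open>Size bounds inspect only the last configuration of a path, so the run is cut
    right after position \<open>i\<close>.\<close>
  let ?f = "map r [0..<Suc i]"
  have "last ?f = (Loc l, Tr t, s)"
    by (simp add: i)
  then have "y \<le> Sup {ennreal (real_of_int \<bar>s x\<bar>) | f l s.
      admissible P S s0 f \<and> last f = (l, Tr t, s)}"
    unfolding y using r[of i] by (intro Sup_upper) blast
  also have "\<dots> \<le> SB (t, x) (abs_state s0)"
    using SB S t P(2) by (auto simp: size_bound_def)
  also have "\<dots> \<le> (\<Sum>t\<in>{t \<in> g. tgt t = l}. SB (t, x) (abs_state s0))"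
    using P(1) t \<open>tgt t = l\<close> by (intro member_le_sum) auto
  finally show "y \<le> (\<Sum>t\<in>{t \<in> g. tgt t = l}. SB (t, x) (abs_state s0))" .
qed

text \<open>The bound \<open>b\<close> does not depend on the run and the total mass is one, so
  \<open>b\<close> integrates to itself.\<close>

lemma nn_integral_run_measure_le:
  assumes "\<And>r. (\<And>n. admissible P S s0 (map r [0..<Suc n])) \<Longrightarrow> X r \<le> b"
  shows "(\<integral>\<^sup>+ r. X r \<partial>run_measure P S s0) \<le> b"
proof -
  interpret prob_space "run_measure P S s0"
    by (rule prob_space_run_measure)
  have "(\<integral>\<^sup>+ r. X r \<partial>run_measure P S s0) \<le> (\<integral>\<^sup>+ r. b \<partial>run_measure P S s0)"
  proof (rule nn_integral_mono_AE)
    show "AE r in run_measure P S s0. X r \<le> b"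
      using AE_prefix_admissible by eventually_elim (blast intro: assms)
  qed
  then show ?thesis
    by (simp add: emeasure_space_1)
qed

theorem theorem1:
  fixes P :: "('l, 'v::finite) pip"
    and RT :: "('l, 'v) transition \<Rightarrow> 'v bound"
    and SB :: "('l, 'v) transition \<times> 'v \<Rightarrow> 'v bound"
  assumes "is_pip P"
    and "runtime_bound P RT"
    and "size_bound P SB"
  shows "expected_bound_pair P
           (\<lambda>g. \<lambda>\<sigma>. \<Sum>t\<in>g. RT t \<sigma>)
           (\<lambda>(g, l, x). \<lambda>\<sigma>. \<Sum>t\<in>{t \<in> g. tgt t = l}. SB (t, x) \<sigma>)"
proof -
  \<comment> \<open>Finiteness keeps the sums genuine, since a sum over an infinite set defaults to
    0; the inclusion makes the classical bounds available for every summand.\<close>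
  have fin: "finite g" and sub: "g \<subseteq> transitions P" if "g \<in> gts P" for g
    using assms(1) that by (auto simp: is_pip_def wf_gen_transition_def transitions_def)
  have "expected_runtime_bound P (\<lambda>g \<sigma>. \<Sum>t\<in>g. RT t \<sigma>)"
    unfolding expected_runtime_bound_def
  proof (intro ballI conjI allI impI)
    fix g assume g: "g \<in> gts P"
    show "(\<lambda>\<sigma>. \<Sum>t\<in>g. RT t \<sigma>) \<in> bounds (pvars P)"
      using assms(2) sub[OF g] by (intro sum_in_bounds) (auto simp: runtime_bound_def)
    show "(\<integral>\<^sup>+ r. runtime_rv g r \<partial>run_measure P S s0) \<le> (\<Sum>t\<in>g. RT t (abs_state s0))"
      if "is_scheduler P S" for S s0
      by (intro nn_integral_run_measure_le runtime_rv_le[OF fin[OF g] sub[OF g] assms(2) that])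
  qed
  moreover have "expected_size_bound P
      (\<lambda>(g, l, x) \<sigma>. \<Sum>t\<in>{t \<in> g. tgt t = l}. SB (t, x) \<sigma>)"
    unfolding expected_size_bound_def
  proof (intro ballI)
    fix \<alpha> assume "\<alpha> \<in> GRV P"
    then obtain g l x where \<alpha>: "\<alpha> = (g, l, x)" and g: "g \<in> gts P"
      by (auto simp: GRV_def)
    have "(\<lambda>\<sigma>. \<Sum>t\<in>{t \<in> g. tgt t = l}. SB (t, x) \<sigma>) \<in> bounds (pvars P)"
      using assms(3) sub[OF g] by (intro sum_in_bounds) (auto simp: size_bound_def)
    moreover have "(\<integral>\<^sup>+ r. size_rv (g, l, x) r \<partial>run_measure P S s0) \<le>
        (\<Sum>t\<in>{t \<in> g. tgt t = l}. SB (t, x) (abs_state s0))" if "is_scheduler P S" for S s0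
      by (intro nn_integral_run_measure_le size_rv_le[OF fin[OF g] sub[OF g] assms(3) that])
    ultimately show "(case \<alpha> of (g, l, x) \<Rightarrow> \<lambda>\<sigma>. \<Sum>t\<in>{t \<in> g. tgt t = l}. SB (t, x) \<sigma>) \<in>
          bounds (pvars P) \<and>
        (\<forall>S s0. is_scheduler P S \<longrightarrow>
          (\<integral>\<^sup>+ r. size_rv \<alpha> r \<partial>run_measure P S s0) \<le>
          (case \<alpha> of (g, l, x) \<Rightarrow> \<lambda>\<sigma>. \<Sum>t\<in>{t \<in> g. tgt t = l}. SB (t, x) \<sigma>) (abs_state s0))"
      by (simp add: \<alpha>)
  qed
  ultimately show ?thesis
    by (simp add: expected_bound_pair_def)
qed

end
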